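(* Let $G$ be a bipartite graph of order $n$ with dissociation number $\tau$, and let $\alpha\in[0,1)$. Then $$\lambda_\alpha(G)\le \frac12\left(\alpha n+\sqrt{\alpha^2n^2+4\tau(n-\tau)(1-2\alpha)}\right),$$ with equality if and only if $G\cong K_{\tau,n-\tau}$.
   Context: All graphs are simple and finite. For a graph $G$ with adjacency matrix $A(G)$ and diagonal degree matrix $D(G)$, and $\alpha\in[0,1]$, let $A_\alpha(G)=\alpha D(G)+(1-\alpha)A(G)$; its largest eigenvalue $\lambda_\alpha(G)$ is the $A_\alpha$-index of $G$. A set $S\subseteq V(G)$ is a dissociation set if the induced subgraph $G[S]$ has maximum degree at most $1$; the dissociation number of $G$ is the maximum cardinality of a dissociation set. $K_{a,b}$ is the complete bipartite graph with parts of sizes $a$ and $b$.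
   Formalization: The formal theorem assumes τ < n, i.e. G has a vertex of degree at least 2; for τ = n the claim fails as printed (G = K_2, α = 0: index 1, bound 0; edgeless G, α > 0: G = K_{n,0} but no equality). *)

theory Defs
  imports "Graph_Theory.Graph_Theory" "Jordan_Normal_Form.Char_Poly"
begin

text \<open>
  Finite simple graphs are the locale \<^locale>\<open>graph\<close>: finite symmetric digraphs without loops and
  multiple arcs, an edge being a pair of opposite arcs. The degree of a vertex is therefore its
  \<^const>\<open>out_degree\<close>, and \<^const>\<open>complete_bipartite_digraph\<close> says that a graph is isomorphic to the
  complete bipartite graph with parts of the given sizes.
\<close>

definition bipartite_graph :: "('a, 'b) pre_digraph \<Rightarrow> bool" where
  "bipartite_graph G \<longleftrightarrow> graph G \<and>
     (\<exists>X Y. verts G = X \<union> Y \<and> X \<inter> Y = {} \<and> arcs_ends G \<subseteq> X \<times> Y \<union> Y \<times> X)"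

definition dissociation_set :: "('a, 'b) pre_digraph \<Rightarrow> 'a set \<Rightarrow> bool" where
  "dissociation_set G S \<longleftrightarrow> S \<subseteq> verts G \<and> (\<forall>v\<in>S. out_degree (G \<restriction> S) v \<le> 1)"

definition dissociation_number :: "('a, 'b) pre_digraph \<Rightarrow> nat" where
  "dissociation_number G = Max (card ` {S. dissociation_set G S})"

text \<open>
  Matrices have rows and columns indexed by numbers, so those of \<open>G\<close> are written with respect to an
  ordering \<open>vs\<close> of its vertices. Changing \<open>vs\<close> conjugates them by a permutation matrix, which leaves
  the eigenvalues unchanged.
\<close>

definition vertex_ordering :: "('a, 'b) pre_digraph \<Rightarrow> 'a list \<Rightarrow> bool" where
  "vertex_ordering G vs \<longleftrightarrow> distinct vs \<and> set vs = verts G"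

definition adjacency_mat :: "('a, 'b) pre_digraph \<Rightarrow> 'a list \<Rightarrow> real mat" where
  "adjacency_mat G vs = mat (length vs) (length vs)
     (\<lambda>(i, j). if (vs ! i, vs ! j) \<in> arcs_ends G then 1 else 0)"

definition degree_mat :: "('a, 'b) pre_digraph \<Rightarrow> 'a list \<Rightarrow> real mat" where
  "degree_mat G vs = mat_diag (length vs) (\<lambda>i. real (out_degree G (vs ! i)))"

definition A_alpha_mat :: "real \<Rightarrow> ('a, 'b) pre_digraph \<Rightarrow> 'a list \<Rightarrow> real mat" where
  "A_alpha_mat \<alpha> G vs = \<alpha> \<cdot>\<^sub>m degree_mat G vs + (1 - \<alpha>) \<cdot>\<^sub>m adjacency_mat G vs"

definition A_alpha_index :: "real \<Rightarrow> ('a, 'b) pre_digraph \<Rightarrow> 'a list \<Rightarrow> real" where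
  "A_alpha_index \<alpha> G vs = Max {k. eigenvalue (A_alpha_mat \<alpha> G vs) k}"

end

theory Submission
  imports Defs "Jordan_Normal_Form.Spectral_Radius"
begin

text \<open>
  If \<open>A\<^sub>\<alpha> w \<le> \<rho> w\<close> for a positive weight \<open>w\<close>, then every eigenvalue is at most \<open>\<rho>\<close>, and an
  eigenvector for \<open>\<rho>\<close> forces \<open>A\<^sub>\<alpha> w = \<rho> w\<close> on its support, which is a union of components.

  For \<open>\<alpha> < 1/2\<close> take \<open>w u = d(u) + \<rho> - \<alpha> n\<close> with \<open>\<rho>\<close> the claimed bound. The inequality then reduces
  to two estimates for the sum \<open>s(u)\<close> of the degrees of the neighbours of \<open>u\<close>: in a bipartite graph
  \<open>s(u) \<le> d(u) (n - d(u))\<close>, and \<open>s(u) \<le> |E| \<le> \<tau> (n - \<tau>)\<close>. Equality makes every edge incident with a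
  neighbour of \<open>u\<close>, for every \<open>u\<close> in the support, so that \<open>G\<close> is complete bipartite up to isolated
  vertices, and comparing \<open>|E|\<close> with \<open>\<tau> (n - \<tau>)\<close> excludes the latter.

  For \<open>\<alpha> \<ge> 1/2\<close> take for \<open>w\<close> the Perron vector of the complete bipartite graph on the two parts of \<open>G\<close>.
  The larger part has size at most \<open>\<tau>\<close>, and for fixed \<open>n\<close> the bound does not decrease when the
  two sizes move apart.
\<close>

subsection \<open>Eigenvalues and positive supersolutions\<close>

text \<open>This makes the maximum in \<open>A_alpha_index\<close> one over a nonempty set. Over the
  complex numbers an eigenvalue \<open>l\<close> exists; the Hermitian form of a real symmetric
  matrix takes real values, so \<open>l\<close> is real.\<close>

lemma symmetric_real_mat_has_eigenvalue:
  fixes A :: "real mat"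
  assumes A: "A \<in> carrier_mat n n" and "n > 0"
    and sym: "\<And>i j. i < n \<Longrightarrow> j < n \<Longrightarrow> A $$ (i, j) = A $$ (j, i)"
  shows "\<exists>k. eigenvalue A k"
proof -
  let ?B = "map_mat complex_of_real A"
  have B: "?B \<in> carrier_mat n n" using A by simp
  from spectrum_non_empty[OF B \<open>n > 0\<close>] obtain l where l: "eigenvalue ?B l"
    unfolding spectrum_def by blast
  then obtain v where v: "v \<in> carrier_vec n" "v \<noteq> 0\<^sub>v n" "?B *\<^sub>v v = l \<cdot>\<^sub>v v"
    using B unfolding eigenvalue_def eigenvector_def by auto
  have row: "(\<Sum>j<n. complex_of_real (A $$ (i, j)) * v $ j) = l * v $ i" if "i < n" for i
  proof -
    have "(?B *\<^sub>v v) $ i = (\<Sum>j<n. complex_of_real (A $$ (i, j)) * v $ j)"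
      using that A v(1) by (simp add: scalar_prod_def atLeast0LessThan)
    then show ?thesis using v that by simp
  qed
  \<comment> \<open>\<open>q\<close> is the Hermitian form at \<open>v\<close>. The eigenvector
    equation evaluates it to \<open>l * N\<close>, and symmetry of \<open>A\<close> shows that it
    equals its own conjugate.\<close>
  define q where "q = (\<Sum>i<n. \<Sum>j<n. cnj (v $ i) * complex_of_real (A $$ (i, j)) * v $ j)"
  define N where "N = (\<Sum>i<n. (cmod (v $ i))\<^sup>2)"
  have "q = (\<Sum>i<n. cnj (v $ i) * (l * v $ i))"
    unfolding q_def using row by (simp add: mult.assoc flip: sum_distrib_left)
  also have "\<dots> = (\<Sum>i<n. l * complex_of_real ((cmod (v $ i))\<^sup>2))"
    by (intro sum.cong refl) (simp add: complex_norm_square mult_ac del: of_real_power)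
  finally have q: "q = l * complex_of_real N"
    by (simp add: N_def sum_distrib_left)
  have "cnj q = (\<Sum>i<n. \<Sum>j<n. v $ i * complex_of_real (A $$ (i, j)) * cnj (v $ j))"
    by (simp add: q_def)
  also have "\<dots> = (\<Sum>j<n. \<Sum>i<n. v $ i * complex_of_real (A $$ (i, j)) * cnj (v $ j))"
    by (rule sum.swap)
  also have "\<dots> = q"
    unfolding q_def by (intro sum.cong refl) (use sym in \<open>simp add: mult_ac\<close>)
  finally have "cnj q = q" .
  moreover have "N > 0"
  proof -
    obtain i where i: "i < n" "v $ i \<noteq> 0" using v by (metis carrier_vecD eq_vecI index_zero_vec)
    show ?thesis unfolding N_def
      by (rule sum_pos2[of _ i]) (use i in auto)
  qed
  ultimately have "cnj l = l" using q by simp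
  then obtain k where k: "l = complex_of_real k"
    by (metis Reals_cases Reals_cnj_iff)
  \<comment> \<open>Passing through the characteristic polynomial, which has real coefficients,
    avoids extracting a real eigenvector from \<open>v\<close>.\<close>
  have "poly (char_poly ?B) l = 0"
    using l eigenvalue_root_char_poly[OF B] by simp
  then have "poly (char_poly A) k = 0"
    unfolding of_real_hom.char_poly_hom[OF A] k by simp
  then show ?thesis using eigenvalue_root_char_poly[OF A] by blast
qed

definition neighbours :: "('a, 'b) pre_digraph \<Rightarrow> 'a \<Rightarrow> 'a set" where
  "neighbours G u = {v. (u, v) \<in> arcs_ends G}"

text \<open>The action of \<open>A_alpha_mat\<close> on functions on the vertices, which frees the
  later arguments from the ordering \<open>vs\<close>.\<close>

definition A_alpha_op :: "real \<Rightarrow> ('a, 'b) pre_digraph \<Rightarrow> ('a \<Rightarrow> real) \<Rightarrow> 'a \<Rightarrow> real" where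
  "A_alpha_op \<alpha> G f u =
     \<alpha> * real (card (neighbours G u)) * f u + (1 - \<alpha>) * (\<Sum>v\<in>neighbours G u. f v)"

definition eigenfunction ::
    "real \<Rightarrow> ('a, 'b) pre_digraph \<Rightarrow> ('a \<Rightarrow> real) \<Rightarrow> real \<Rightarrow> bool" where
  "eigenfunction \<alpha> G f k \<longleftrightarrow>
     (\<exists>u\<in>verts G. f u \<noteq> 0) \<and> (\<forall>u\<in>verts G. A_alpha_op \<alpha> G f u = k * f u)"

context graph
begin

lemma neighbours_subset: "neighbours G u \<subseteq> verts G"
  by (auto simp: neighbours_def adj_in_verts)

lemma finite_neighbours [simp]: "finite (neighbours G u)"
  using neighbours_subset finite_verts by (rule finite_subset)

lemma arcs_ends_sym: "(u, v) \<in> arcs_ends G \<longleftrightarrow> (v, u) \<in> arcs_ends G"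
  using arcs_ends_symmetric[OF sym_arcs] by blast

lemma neighbours_sym: "v \<in> neighbours G u \<longleftrightarrow> u \<in> neighbours G v"
  unfolding neighbours_def using arcs_ends_sym by blast

lemma out_degree_eq_card_neighbours: "out_degree G u = card (neighbours G u)"
proof -
  have "bij_betw (head G) (out_arcs G u) (neighbours G u)"
    unfolding bij_betw_def
  proof
    show "inj_on (head G) (out_arcs G u)"
      by (rule inj_onI) (auto intro!: no_multi_arcs simp: arc_to_ends_def)
    show "head G ` out_arcs G u = neighbours G u"
      by (auto simp: neighbours_def arcs_ends_conv image_iff)
  qed
  then show ?thesis unfolding out_degree_def by (rule bij_betw_same_card)
qed

lemma out_degree_induce_subgraph:
  assumes "v \<in> S"
  shows "out_degree (G \<restriction> S) v = card (neighbours G v \<inter> S)"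
proof -
  have "bij_betw (head G) (out_arcs (G \<restriction> S) v) (neighbours G v \<inter> S)"
    unfolding bij_betw_def
  proof
    show "inj_on (head G) (out_arcs (G \<restriction> S) v)"
      by (rule inj_onI) (auto intro!: no_multi_arcs simp: arc_to_ends_def)
    show "head G ` out_arcs (G \<restriction> S) v = neighbours G v \<inter> S"
      using assms by (auto simp: neighbours_def arcs_ends_conv image_iff)
  qed
  then show ?thesis unfolding out_degree_def by (rule bij_betw_same_card)
qed

lemma dissociation_set_iff:
  "dissociation_set G S \<longleftrightarrow> S \<subseteq> verts G \<and> (\<forall>v\<in>S. card (neighbours G v \<inter> S) \<le> 1)"
  by (simp add: dissociation_set_def out_degree_induce_subgraph)

lemma finite_dissociation_sets: "finite {S. dissociation_set G S}"
  by (rule finite_subset[of _ "Pow (verts G)"]) (auto simp: dissociation_set_def)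

lemma card_le_dissociation_number:
  assumes "dissociation_set G S"
  shows "card S \<le> dissociation_number G"
  unfolding dissociation_number_def using assms finite_dissociation_sets by (auto intro: Max_ge)

lemma dissociation_number_attained:
  obtains S where "dissociation_set G S" "card S = dissociation_number G"
proof -
  have "dissociation_set G {}" by (simp add: dissociation_set_def)
  then have "dissociation_number G \<in> card ` {S. dissociation_set G S}"
    unfolding dissociation_number_def using finite_dissociation_sets by (intro Max_in) auto
  then show thesis using that by auto
qed

lemma independent_card_le_dissociation_number:
  assumes "S \<subseteq> verts G" "arcs_ends G \<inter> S \<times> S = {}"
  shows "card S \<le> dissociation_number G"
proof (rule card_le_dissociation_number)
  have "neighbours G v \<inter> S = {}" if "v \<in> S" for v
    using that assms by (auto simp: neighbours_def)
  then show "dissociation_set G S" using assms by (simp add: dissociation_set_iff)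
qed

lemma A_alpha_mat_mult_vec:
  assumes vs: "vertex_ordering G vs" and "i < length vs"
  shows "(A_alpha_mat \<alpha> G vs *\<^sub>v vec (length vs) (\<lambda>j. f (vs ! j))) $ i = A_alpha_op \<alpha> G f (vs ! i)"
proof -
  let ?N = "length vs" and ?u = "vs ! i"
  have "(A_alpha_mat \<alpha> G vs *\<^sub>v vec ?N (\<lambda>j. f (vs ! j))) $ i =
      (\<Sum>j<?N. (\<alpha> * (if i = j then real (out_degree G ?u) else 0)
        + (1 - \<alpha>) * (if (?u, vs ! j) \<in> arcs_ends G then 1 else 0)) * f (vs ! j))"
    using assms(2)
    by (auto simp: A_alpha_mat_def degree_mat_def adjacency_mat_def mat_diag_def
        scalar_prod_def atLeast0LessThan intro!: sum.cong)
  also have "\<dots> = (\<Sum>j<?N. if i = j then \<alpha> * real (out_degree G ?u) * f (vs ! j) else 0)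
      + (1 - \<alpha>) * (\<Sum>j<?N. if (?u, vs ! j) \<in> arcs_ends G then f (vs ! j) else 0)"
    unfolding sum_distrib_left sum.distrib[symmetric]
    by (intro sum.cong refl) (simp add: algebra_simps)
  also have "(\<Sum>j<?N. if (?u, vs ! j) \<in> arcs_ends G then f (vs ! j) else 0)
      = (\<Sum>v\<in>verts G. if (?u, v) \<in> arcs_ends G then f v else 0)"
    using vs unfolding vertex_ordering_def
    by (intro sum.reindex_bij_betw bij_betw_nth) auto
  also have "\<dots> = (\<Sum>v\<in>neighbours G ?u. f v)"
    by (rule sum.mono_neutral_cong_right)
      (use neighbours_subset in \<open>auto simp: neighbours_def\<close>)
  finally show ?thesis
    using assms(2) by (simp add: A_alpha_op_def out_degree_eq_card_neighbours)
qed

lemma eigenvalue_A_alpha_mat_iff: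
  assumes vs: "vertex_ordering G vs"
  shows "eigenvalue (A_alpha_mat \<alpha> G vs) k \<longleftrightarrow> (\<exists>f. eigenfunction \<alpha> G f k)"
proof -
  let ?N = "length vs" and ?A = "A_alpha_mat \<alpha> G vs"
  have A: "?A \<in> carrier_mat ?N ?N"
    by (simp add: A_alpha_mat_def degree_mat_def adjacency_mat_def mat_diag_def)
  have d: "distinct vs" and V: "verts G = set vs" using vs by (auto simp: vertex_ordering_def)
  show ?thesis
  proof
    assume "eigenvalue ?A k"
    then obtain x where x: "x \<in> carrier_vec ?N" "x \<noteq> 0\<^sub>v ?N" "?A *\<^sub>v x = k \<cdot>\<^sub>v x"
      using A unfolding eigenvalue_def eigenvector_def by auto
    define f where "f v = x $ (the_inv_into {..<?N} ((!) vs) v)" for v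
    have f: "f (vs ! i) = x $ i" if "i < ?N" for i
      using that d by (simp add: f_def the_inv_into_f_f inj_on_nth)
    have xf: "x = vec ?N (\<lambda>i. f (vs ! i))"
      using x(1) f by (intro eq_vecI) auto
    obtain i where "i < ?N" "x $ i \<noteq> 0" using x by (metis carrier_vecD eq_vecI index_zero_vec)
    then have "\<exists>u\<in>verts G. f u \<noteq> 0" using f V by (metis nth_mem)
    moreover have "A_alpha_op \<alpha> G f u = k * f u" if u: "u \<in> verts G" for u
    proof -
      obtain i where i: "i < ?N" "u = vs ! i" using u V by (auto simp: in_set_conv_nth)
      have "A_alpha_op \<alpha> G f u = (?A *\<^sub>v x) $ i"
        using A_alpha_mat_mult_vec[OF vs i(1), of \<alpha> f] xf i(2) by simp
      then show ?thesis using x i f by simp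
    qed
    ultimately show "\<exists>f. eigenfunction \<alpha> G f k" unfolding eigenfunction_def by blast
  next
    assume "\<exists>f. eigenfunction \<alpha> G f k"
    then obtain f u where f: "\<And>u. u \<in> verts G \<Longrightarrow> A_alpha_op \<alpha> G f u = k * f u"
      and u: "u \<in> verts G" "f u \<noteq> 0"
      unfolding eigenfunction_def by auto
    let ?x = "vec ?N (\<lambda>i. f (vs ! i))"
    obtain i where i: "i < ?N" "u = vs ! i" using u V by (auto simp: in_set_conv_nth)
    then have "?x $ i \<noteq> 0\<^sub>v ?N $ i" using u by simp
    then have "?x \<noteq> 0\<^sub>v ?N" by metis
    moreover have "?A *\<^sub>v ?x = k \<cdot>\<^sub>v ?x"
    proof (rule eq_vecI)
      show "dim_vec (?A *\<^sub>v ?x) = dim_vec (k \<cdot>\<^sub>v ?x)" using A by simp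
      fix i assume "i < dim_vec (k \<cdot>\<^sub>v ?x)"
      then have i: "i < ?N" by simp
      then show "(?A *\<^sub>v ?x) $ i = (k \<cdot>\<^sub>v ?x) $ i"
        using f[of "vs ! i"] V A_alpha_mat_mult_vec[OF vs i, of \<alpha> f] by simp
    qed
    ultimately show "eigenvalue ?A k"
      using A unfolding eigenvalue_def eigenvector_def by (intro exI[of _ ?x]) auto
  qed
qed

lemma
  assumes vs: "vertex_ordering G vs" and "verts G \<noteq> {}"
  shows A_alpha_index_attained: "\<exists>f. eigenfunction \<alpha> G f (A_alpha_index \<alpha> G vs)"
    and A_alpha_index_ge: "eigenfunction \<alpha> G f k \<Longrightarrow> k \<le> A_alpha_index \<alpha> G vs"
proof -
  let ?N = "length vs" and ?A = "A_alpha_mat \<alpha> G vs"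
  have A: "?A \<in> carrier_mat ?N ?N"
    by (simp add: A_alpha_mat_def degree_mat_def adjacency_mat_def mat_diag_def)
  have "?N > 0" using assms by (auto simp: vertex_ordering_def)
  moreover have "?A $$ (i, j) = ?A $$ (j, i)" if "i < ?N" "j < ?N" for i j
    using that arcs_ends_sym
    by (auto simp: A_alpha_mat_def degree_mat_def adjacency_mat_def mat_diag_def)
  ultimately have ne: "{k. eigenvalue ?A k} \<noteq> {}"
    using symmetric_real_mat_has_eigenvalue[OF A] by blast
  have fin: "finite {k. eigenvalue ?A k}"
    using card_finite_spectrum(1)[OF A] by (simp add: spectrum_def)
  show "\<exists>f. eigenfunction \<alpha> G f (A_alpha_index \<alpha> G vs)"
    using Max_in[OF fin ne] eigenvalue_A_alpha_mat_iff[OF vs] by (simp add: A_alpha_index_def)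
  show "k \<le> A_alpha_index \<alpha> G vs" if "eigenfunction \<alpha> G f k"
    unfolding A_alpha_index_def
    by (rule Max_ge[OF fin]) (use that eigenvalue_A_alpha_mat_iff[OF vs] in blast)
qed

text \<open>The degree part is diagonal; in the adjacency part the two summations are exchanged and
  the arcs reversed.\<close>

lemma A_alpha_op_self_adjoint:
  "(\<Sum>u\<in>verts G. f u * A_alpha_op \<alpha> G g u) = (\<Sum>u\<in>verts G. g u * A_alpha_op \<alpha> G f u)"
proof -
  let ?a = "\<lambda>u v. if (u, v) \<in> arcs_ends G then 1 else 0 :: real"
  have nb: "(\<Sum>v\<in>neighbours G u. h v) = (\<Sum>v\<in>verts G. ?a u v * h v)" for u and h :: "'a \<Rightarrow> real"
    by (rule sum.mono_neutral_cong_left)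
      (use neighbours_subset in \<open>auto simp: neighbours_def\<close>)
  have exp: "(\<Sum>u\<in>verts G. f u * A_alpha_op \<alpha> G g u) =
      (\<Sum>u\<in>verts G. \<alpha> * real (card (neighbours G u)) * f u * g u)
      + (1 - \<alpha>) * (\<Sum>u\<in>verts G. \<Sum>v\<in>verts G. ?a u v * f u * g v)" for f g
    unfolding A_alpha_op_def nb sum_distrib_left sum.distrib[symmetric] distrib_left
    by (intro sum.cong refl arg_cong2[where f = "(+)"]) (simp_all add: mult_ac)
  have "(\<Sum>u\<in>verts G. \<Sum>v\<in>verts G. ?a u v * f u * g v)
      = (\<Sum>v\<in>verts G. \<Sum>u\<in>verts G. ?a u v * f u * g v)"
    by (rule sum.swap)
  also have "\<dots> = (\<Sum>v\<in>verts G. \<Sum>u\<in>verts G. ?a v u * g v * f u)"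
    by (intro sum.cong refl) (use arcs_ends_sym in auto)
  finally show ?thesis unfolding exp by (simp add: mult_ac)
qed

text \<open>
  The weight \<open>w\<close> is paired with \<open>\<bar>x\<bar>\<close>, which satisfies \<open>k \<bar>x\<bar> \<le> A\<^sub>\<alpha> \<bar>x\<bar>\<close>.
\<close>

lemma
  assumes \<alpha>: "0 \<le> \<alpha>" "\<alpha> < 1" and x: "eigenfunction \<alpha> G x k"
    and w: "\<And>u. u \<in> verts G \<Longrightarrow> 0 < w u"
    and super: "\<And>u. u \<in> verts G \<Longrightarrow> A_alpha_op \<alpha> G w u \<le> \<rho> * w u"
  shows eigenvalue_le_supersolution: "k \<le> \<rho>"
    and supersolution_tight:
      "k = \<rho> \<Longrightarrow> u \<in> verts G \<Longrightarrow> x u \<noteq> 0 \<Longrightarrow> A_alpha_op \<alpha> G w u = \<rho> * w u"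
    and support_closed:
      "k = \<rho> \<Longrightarrow> u \<in> verts G \<Longrightarrow> x u \<noteq> 0 \<Longrightarrow> v \<in> neighbours G u \<Longrightarrow> x v \<noteq> 0"
proof -
  define y where "y u = \<bar>x u\<bar>" for u
  have sub: "k * y u \<le> A_alpha_op \<alpha> G y u" if "u \<in> verts G" for u
  proof -
    have "k * y u \<le> \<bar>k * x u\<bar>"
      by (simp add: y_def abs_mult mult_right_mono)
    also have "\<dots> = \<bar>A_alpha_op \<alpha> G x u\<bar>" using x that by (simp add: eigenfunction_def)
    also have "\<dots> \<le> \<bar>\<alpha> * real (card (neighbours G u)) * x u\<bar> + \<bar>(1 - \<alpha>) * sum x (neighbours G u)\<bar>"
      unfolding A_alpha_op_def by (rule abs_triangle_ineq)
    also have "\<dots> \<le> A_alpha_op \<alpha> G y u"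
      unfolding A_alpha_op_def y_def using \<alpha>
      by (auto simp: abs_mult intro!: mult_left_mono sum_abs)
    finally show ?thesis .
  qed
  obtain u0 where u0: "u0 \<in> verts G" "x u0 \<noteq> 0" using x by (auto simp: eigenfunction_def)
  define W where "W = (\<Sum>u\<in>verts G. w u * y u)"
  have W: "W > 0" unfolding W_def
    by (rule sum_pos2[of _ u0]) (use u0 w in \<open>auto simp: y_def less_imp_le\<close>)
  have nn1: "0 \<le> w u * (A_alpha_op \<alpha> G y u - k * y u)" if "u \<in> verts G" for u
    using sub[OF that] w[OF that] by simp
  have nn2: "0 \<le> y u * (\<rho> * w u - A_alpha_op \<alpha> G w u)" if "u \<in> verts G" for u
    using super[OF that] by (simp add: y_def)
  \<comment> \<open>By self-adjointness the two terms containing \<open>A_alpha_op\<close> cancel,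
    so the nonnegative defects of \<open>y\<close> and \<open>w\<close> add up to
    \<open>(\<rho> - k) * W\<close>. For \<open>k = \<rho>\<close> every one of them must
    vanish.\<close>
  have eq: "(\<Sum>u\<in>verts G. w u * (A_alpha_op \<alpha> G y u - k * y u)
      + y u * (\<rho> * w u - A_alpha_op \<alpha> G w u)) = (\<rho> - k) * W"
    using A_alpha_op_self_adjoint[of w \<alpha> y]
    by (simp add: sum.distrib sum_subtractf W_def sum_distrib_left algebra_simps)
  moreover have "0 \<le> (\<Sum>u\<in>verts G. w u * (A_alpha_op \<alpha> G y u - k * y u)
      + y u * (\<rho> * w u - A_alpha_op \<alpha> G w u))"
    using nn1 nn2 by (intro sum_nonneg) (simp add: add_nonneg_nonneg)
  ultimately show "k \<le> \<rho>" using W by (simp add: zero_le_mult_iff)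
  assume "k = \<rho>"
  have all0: "w u * (A_alpha_op \<alpha> G y u - k * y u) + y u * (\<rho> * w u - A_alpha_op \<alpha> G w u) = 0"
    if "u \<in> verts G" for u
    using sum_nonneg_0[OF finite_verts _ _ that, of "\<lambda>u. w u * (A_alpha_op \<alpha> G y u - k * y u)
      + y u * (\<rho> * w u - A_alpha_op \<alpha> G w u)"] eq \<open>k = \<rho>\<close> nn1 nn2
    by (simp add: add_nonneg_nonneg)
  have y_eq: "A_alpha_op \<alpha> G y u = k * y u"
    and w_eq: "y u * (\<rho> * w u - A_alpha_op \<alpha> G w u) = 0" if "u \<in> verts G" for u
    using all0[OF that] nn1[OF that] nn2[OF that] w[OF that]
    by (auto simp: add_nonneg_eq_0_iff)
  show "A_alpha_op \<alpha> G w u = \<rho> * w u" if "u \<in> verts G" "x u \<noteq> 0"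
    using w_eq[OF that(1)] that(2) by (simp add: y_def)
  show "x v \<noteq> 0" if "u \<in> verts G" "x u \<noteq> 0" "v \<in> neighbours G u"
  proof
    assume "x v = 0"
    have v: "v \<in> verts G" "u \<in> neighbours G v" using that neighbours_subset neighbours_sym by auto
    \<comment> \<open>At a zero of \<open>y\<close> the equation for \<open>y\<close> leaves only
      \<open>1 - \<alpha>\<close>, which is positive, times a sum of nonnegative values over the
      neighbours.\<close>
    have "(\<Sum>a\<in>neighbours G v. y a) = 0"
      using y_eq[OF v(1)] \<open>x v = 0\<close> \<alpha> by (simp add: A_alpha_op_def y_def)
    then have "y u = 0" using v(2) by (simp add: sum_nonneg_eq_0_iff y_def)
    then show False using that by (simp add: y_def)
  qed
qed

end

subsection \<open>The bound for complete bipartite graphs\<close>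

text \<open>The larger root \<open>r\<close> of \<open>(r - \<alpha> * a) * (r - \<alpha> * b) = (1
  - \<alpha>)\<^sup>2 * a * b\<close>; for part sizes \<open>a\<close> and \<open>b\<close> it is
  the index of the complete bipartite graph.\<close>

definition A_alpha_bound :: "real \<Rightarrow> real \<Rightarrow> real \<Rightarrow> real" where
  "A_alpha_bound \<alpha> a b =
     1/2 * (\<alpha> * (a + b) + sqrt (\<alpha>\<^sup>2 * (a + b)\<^sup>2 + 4 * a * b * (1 - 2 * \<alpha>)))"

text \<open>The radicand is also \<open>(\<alpha> * (a - b))\<^sup>2 + 4 * a * b * (1 -
  \<alpha>)\<^sup>2\<close>, which gives the root equation and the first two inequalities. The
  inequalities serve to make the weights used later positive.\<close>

lemma
  fixes \<alpha> a b :: real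
  assumes \<alpha>: "0 \<le> \<alpha>" "\<alpha> < 1" and ab: "0 < a" "0 < b"
  defines "r \<equiv> A_alpha_bound \<alpha> a b"
  shows A_alpha_bound_root: "(r - \<alpha> * a) * (r - \<alpha> * b) = (1 - \<alpha>)\<^sup>2 * a * b"
    and A_alpha_bound_greater: "\<alpha> * a < r" "\<alpha> * b < r"
    and A_alpha_bound_greater_sum: "\<alpha> < 1/2 \<Longrightarrow> \<alpha> * (a + b) < r"
proof -
  let ?D = "\<alpha>\<^sup>2 * (a + b)\<^sup>2 + 4 * a * b * (1 - 2 * \<alpha>)"
  have D: "?D = (\<alpha> * (a - b))\<^sup>2 + 4 * a * b * (1 - \<alpha>)\<^sup>2"
    by (simp add: power2_eq_square algebra_simps)
  have pos: "4 * a * b * (1 - \<alpha>)\<^sup>2 > 0" using \<alpha> ab by simp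
  then have gt: "?D > (\<alpha> * (a - b))\<^sup>2" using D by linarith
  then have D0: "?D \<ge> 0" using zero_le_power2[of "\<alpha> * (a - b)"] by linarith
  define s where "s = sqrt ?D"
  have s2: "s\<^sup>2 = ?D" unfolding s_def using D0 by (rule real_sqrt_pow2)
  have s: "s > \<bar>\<alpha> * (a - b)\<bar>"
    unfolding s_def real_sqrt_abs[symmetric] using gt by (rule real_sqrt_less_mono)
  have r: "r = (\<alpha> * (a + b) + s) / 2" by (simp add: r_def A_alpha_bound_def s_def)
  show "\<alpha> * a < r"
    using s unfolding r abs_less_iff right_diff_distrib distrib_left by simp
  show "\<alpha> * b < r"
    using s unfolding r abs_less_iff right_diff_distrib distrib_left by simp
  have "(r - \<alpha> * a) * (r - \<alpha> * b) = (s\<^sup>2 - (\<alpha> * (a - b))\<^sup>2) / 4"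
    unfolding r by (simp add: power2_eq_square field_simps)
  then show "(r - \<alpha> * a) * (r - \<alpha> * b) = (1 - \<alpha>)\<^sup>2 * a * b"
    unfolding s2 D by simp
  show "\<alpha> * (a + b) < r" if "\<alpha> < 1/2"
  proof -
    have "(\<alpha> * (a + b))\<^sup>2 < ?D" using that ab by (simp add: power_mult_distrib)
    then have "\<alpha> * (a + b) < s" unfolding s_def by (rule real_less_rsqrt)
    then show ?thesis unfolding r by simp
  qed
qed

lemma A_alpha_bound_antimono:
  assumes "1/2 \<le> \<alpha>" "a + b = c + d" "c * d \<le> a * b"
  shows "A_alpha_bound \<alpha> a b \<le> A_alpha_bound \<alpha> c d"
proof -
  have "a * b * (1 - 2 * \<alpha>) \<le> c * d * (1 - 2 * \<alpha>)"
    using assms by (intro mult_right_mono_neg) auto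
  then have "4 * a * b * (1 - 2 * \<alpha>) \<le> 4 * c * d * (1 - 2 * \<alpha>)" by simp
  then show ?thesis unfolding A_alpha_bound_def assms(2) by simp
qed

section \<open>Graphs with a fixed bipartition\<close>

locale bipartition = graph G for G :: "('a, 'b) pre_digraph" (structure) +
  fixes X Y :: "'a set"
  assumes verts_eq: "verts G = X \<union> Y" and disjoint: "X \<inter> Y = {}"
    and arcs_ends_subset: "arcs_ends G \<subseteq> X \<times> Y \<union> Y \<times> X"
begin

lemma bipartition_swap: "bipartition G Y X"
  using verts_eq disjoint arcs_ends_subset by unfold_locales auto

lemma finite_parts [simp]: "finite X" "finite Y"
  using finite_verts verts_eq by auto

lemma card_verts: "card (verts G) = card X + card Y"
  using disjoint by (simp add: verts_eq card_Un_disjoint)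

lemma neighbours_subset_parts:
  "u \<in> X \<Longrightarrow> neighbours G u \<subseteq> Y" "u \<in> Y \<Longrightarrow> neighbours G u \<subseteq> X"
  using arcs_ends_subset disjoint by (auto simp: neighbours_def)

lemma card_part_le_dissociation_number:
  "card X \<le> dissociation_number G" "card Y \<le> dissociation_number G"
  using verts_eq disjoint arcs_ends_subset
  by (auto intro!: independent_card_le_dissociation_number)

text \<open>Each edge appears once, directed from \<open>X\<close> to \<open>Y\<close>, whereas
  \<open>arcs_ends G\<close> contains both directions; so \<open>card edges\<close> is the number of
  edges.\<close>

definition edges :: "('a \<times> 'a) set" where
  "edges = arcs_ends G \<inter> X \<times> Y"

lemma edges_subset: "edges \<subseteq> X \<times> Y"
  by (simp add: edges_def)

lemma finite_edges [simp]: "finite edges"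
  unfolding edges_def by (rule finite_subset[of _ "X \<times> Y"]) auto

lemma edges_iff_neighbours:
  "b \<in> Y \<Longrightarrow> (a, b) \<in> edges \<longleftrightarrow> a \<in> neighbours G b"
  "a \<in> X \<Longrightarrow> (a, b) \<in> edges \<longleftrightarrow> b \<in> neighbours G a"
  using neighbours_subset_parts arcs_ends_sym[of a b] unfolding edges_def neighbours_def by blast+

text \<open>The neighbours of \<open>u\<close> all lie in \<open>Y\<close> and an edge has just one
  end there, so no edge is counted twice.\<close>

lemma sum_neighbour_degrees:
  assumes "u \<in> X"
  shows "(\<Sum>v\<in>neighbours G u. card (neighbours G v)) = card {e \<in> edges. snd e \<in> neighbours G u}"
proof -
  have "(\<Sum>v\<in>neighbours G u. card (neighbours G v)) = card (Sigma (neighbours G u) (neighbours G))"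
    by (simp add: card_SigmaI)
  also have "\<dots> = card (prod.swap ` Sigma (neighbours G u) (neighbours G))"
    by (simp add: card_image)
  also have "prod.swap ` Sigma (neighbours G u) (neighbours G) = {e \<in> edges. snd e \<in> neighbours G u}"
    using edges_iff_neighbours(1) neighbours_subset_parts(1)[OF assms] by (auto simp: image_iff)
  finally show ?thesis .
qed

lemma sum_neighbour_degrees_le_edges:
  assumes "u \<in> X"
  shows "(\<Sum>v\<in>neighbours G u. card (neighbours G v)) \<le> card edges"
  unfolding sum_neighbour_degrees[OF assms] by (rule card_mono) auto

text \<open>If the degree sum reaches the number of edges, then the edges at neighbours of
  \<open>u\<close> are all the edges, and \<open>u\<close> is adjacent to the \<open>Y\<close>-end
  of each.\<close>

lemma edges_if_sum_neighbour_degrees_ge: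
  assumes "u \<in> X" "card edges \<le> (\<Sum>v\<in>neighbours G u. card (neighbours G v))"
    "(a, b) \<in> edges"
  shows "(u, b) \<in> edges"
proof -
  have "{e \<in> edges. snd e \<in> neighbours G u} = edges"
    using assms(2) unfolding sum_neighbour_degrees[OF assms(1)] by (rule card_seteq[rotated 2]) auto
  then have "(a, b) \<in> {e \<in> edges. snd e \<in> neighbours G u}" using assms(3) by (simp only:)
  then have "b \<in> neighbours G u" by simp
  then show ?thesis using edges_iff_neighbours(2) assms(1) by blast
qed

text \<open>
  A maximum dissociation set meets \<open>X\<close> and \<open>Y\<close> in \<open>a\<close> and \<open>b\<close> vertices and spans at most
  \<open>min a b\<close> edges. With \<open>c\<close> and \<open>d\<close> vertices of \<open>X\<close> and \<open>Y\<close> left over, the edges therefore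
  number at most \<open>min a b + a d + c b + c d\<close>; since \<open>X\<close> and \<open>Y\<close> are independent, \<open>c \<le> b\<close> and
  \<open>d \<le> a\<close>, which absorbs the first and last term into \<open>a c + b d\<close>.
\<close>

lemma card_edges_le:
  assumes "dissociation_number G < card (verts G)"
  shows "card edges \<le> dissociation_number G * (card (verts G) - dissociation_number G)"
proof -
  let ?\<tau> = "dissociation_number G"
  obtain S where S: "dissociation_set G S" "card S = ?\<tau>" by (rule dissociation_number_attained)
  have SV: "S \<subseteq> X \<union> Y" and S1: "\<And>v. v \<in> S \<Longrightarrow> card (neighbours G v \<inter> S) \<le> 1"
    using S by (auto simp: dissociation_set_iff verts_eq)
  define a b c d where "a = card (X \<inter> S)" and "b = card (Y \<inter> S)"
    and "c = card (X - S)" and "d = card (Y - S)"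
  have X: "card X = a + c" and Y: "card Y = b + d"
    unfolding a_def b_def c_def d_def by (rule card_Int_Diff; simp)+
  have "S = (X \<inter> S) \<union> (Y \<inter> S)" using SV by blast
  then have "card S = card ((X \<inter> S) \<union> (Y \<inter> S))" by (rule arg_cong)
  also have "\<dots> = a + b"
    unfolding a_def b_def using disjoint by (intro card_Un_disjoint) auto
  finally have \<tau>: "?\<tau> = a + b" using S by simp
  have cd: "c \<le> b" "d \<le> a" "c + d > 0"
    using card_part_le_dissociation_number assms by (simp_all add: card_verts X Y \<tau>)
  \<comment> \<open>\<open>M\<close> is a matching because \<open>S\<close> is a dissociation set;
    counting it from either side bounds it by \<open>a\<close> and by \<open>b\<close>.\<close>
  define M where "M = edges \<inter> S \<times> S"
  have inj1: "card M \<le> a"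
  proof -
    have "M = Sigma (X \<inter> S) (\<lambda>v. neighbours G v \<inter> S)"
      using edges_iff_neighbours(2) edges_subset by (auto simp: M_def)
    then have "card M = (\<Sum>v\<in>X \<inter> S. card (neighbours G v \<inter> S))" by (simp add: card_SigmaI)
    also have "\<dots> \<le> (\<Sum>v\<in>X \<inter> S. 1)" using S1 by (intro sum_mono) auto
    finally show ?thesis by (simp add: a_def)
  qed
  have inj2: "card M \<le> b"
  proof -
    have "M = prod.swap ` Sigma (Y \<inter> S) (\<lambda>v. neighbours G v \<inter> S)"
      using edges_iff_neighbours(1) edges_subset by (auto simp: M_def image_iff)
    then have "card M = (\<Sum>v\<in>Y \<inter> S. card (neighbours G v \<inter> S))"
      by (simp add: card_image card_SigmaI)
    also have "\<dots> \<le> (\<Sum>v\<in>Y \<inter> S. 1)" using S1 by (intro sum_mono) auto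
    finally show ?thesis by (simp add: b_def)
  qed
  have "edges \<subseteq> M \<union> ((X \<inter> S) \<times> (Y - S) \<union> (X - S) \<times> Y)"
    using edges_subset by (auto simp: M_def)
  then have "card edges \<le> card (M \<union> ((X \<inter> S) \<times> (Y - S) \<union> (X - S) \<times> Y))"
    by (intro card_mono) (simp_all add: M_def)
  also have "\<dots> \<le> card M + (card ((X \<inter> S) \<times> (Y - S)) + card ((X - S) \<times> Y))"
    by (meson add_left_mono card_Un_le le_trans)
  also have "\<dots> = card M + (a * d + c * (b + d))"
    by (simp only: card_cartesian_product Y a_def c_def d_def)
  finally have e: "card edges \<le> card M + (a * d + c * (b + d))" .
  have "card M + c * d \<le> a * c + b * d"
  \<comment> \<open>As \<open>c + d > 0\<close>, one of \<open>c\<close> and \<open>d\<close> is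
    positive: for \<open>d = 0\<close> the matching is absorbed by \<open>a * c\<close>, otherwise
    by \<open>b * d\<close>, while \<open>a * c\<close> absorbs \<open>c * d\<close>.\<close>
  proof (cases "d = 0")
    case True
    then have "1 \<le> c" using cd by simp
    then have "a \<le> a * c" using mult_le_mono2[of 1 c a] by simp
    then show ?thesis using True le_trans[OF inj1] by simp
  next
    case False
    then have "b \<le> b * d" by (cases d) simp_all
    moreover have "c * d \<le> a * c" using mult_le_mono2[OF cd(2), of c] by (simp add: mult.commute)
    ultimately show ?thesis using inj2 by linarith
  qed
  moreover have "card (verts G) - ?\<tau> = c + d" by (simp add: card_verts X Y \<tau>)
  ultimately show ?thesis using e by (simp add: \<tau> algebra_simps)
qed

text \<open>\<open>w\<close> is the Perron vector of the complete bipartite graph on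
  \<open>X\<close> and \<open>Y\<close>. Since \<open>w\<close> is constant on each part,
  \<open>A_alpha_op \<alpha> G w u\<close> is a positive constant of the part of \<open>u\<close>
  times the degree of \<open>u\<close>, so comparing with \<open>r * w u\<close> compares that
  degree with the size of the opposite part.\<close>

lemma A_alpha_op_complete_bipartite:
  assumes \<alpha>: "0 \<le> \<alpha>" "\<alpha> < 1" and ne: "card X > 0" "card Y > 0"
  defines "r \<equiv> A_alpha_bound \<alpha> (card X) (card Y)"
  defines "w \<equiv> \<lambda>u. if u \<in> X then (1 - \<alpha>) * card Y else r - \<alpha> * card Y"
  shows "u \<in> verts G \<Longrightarrow> w u > 0"
    and "u \<in> verts G \<Longrightarrow> A_alpha_op \<alpha> G w u \<le> r * w u"
    and "u \<in> verts G \<Longrightarrow> A_alpha_op \<alpha> G w u = r * w u \<longleftrightarrow> neighbours G u = (if u \<in> X then Y else X)"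
proof -
  let ?p = "(1 - \<alpha>) * card Y" and ?q = "r - \<alpha> * card Y"
  have pq: "?p > 0" "?q > 0"
    using A_alpha_bound_greater(2)[OF \<alpha>, of "card X" "card Y"] \<alpha> ne by (auto simp: r_def)
  then show "w u > 0" if "u \<in> verts G" by (simp add: w_def)
  have root: "(r - \<alpha> * card X) * (r - \<alpha> * card Y) = (1 - \<alpha>)\<^sup>2 * card X * card Y"
    using A_alpha_bound_root[OF \<alpha>] ne by (simp add: r_def)
  have op: "A_alpha_op \<alpha> G w u = card (neighbours G u) * (\<alpha> * w u + (1 - \<alpha>) * z)"
    if "\<And>v. v \<in> neighbours G u \<Longrightarrow> w v = z" for u z
  proof -
    have "(\<Sum>v\<in>neighbours G u. w v) = card (neighbours G u) * z" using that by simp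
    then show ?thesis unfolding A_alpha_op_def by (simp only:) (simp add: algebra_simps)
  qed
  have opX: "A_alpha_op \<alpha> G w u = card (neighbours G u) * (\<alpha> * ?p + (1 - \<alpha>) * ?q)" if "u \<in> X" for u
  proof -
    have "w v = ?q" if "v \<in> neighbours G u" for v
      using that neighbours_subset_parts(1)[OF \<open>u \<in> X\<close>] disjoint by (auto simp: w_def)
    moreover have "w u = ?p" using that by (simp add: w_def)
    ultimately show ?thesis using op[of u ?q] by simp
  qed
  have opY: "A_alpha_op \<alpha> G w u = card (neighbours G u) * (\<alpha> * ?q + (1 - \<alpha>) * ?p)" if "u \<in> Y" for u
  proof -
    have "w v = ?p" if "v \<in> neighbours G u" for v
      using that neighbours_subset_parts(2)[OF \<open>u \<in> Y\<close>] by (auto simp: w_def)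
    moreover have "w u = ?q" using that disjoint by (auto simp: w_def)
    ultimately show ?thesis using op[of u ?p] by simp
  qed
  \<comment> \<open>On \<open>X\<close> the eigenvalue equation holds by the choice of the two
    values of \<open>w\<close>; on \<open>Y\<close> it is the quadratic equation for
    \<open>r\<close>.\<close>
  have cX: "card Y * (\<alpha> * ?p + (1 - \<alpha>) * ?q) = r * ?p" by (simp add: algebra_simps)
  have cY: "card X * (\<alpha> * ?q + (1 - \<alpha>) * ?p) = r * ?q"
  proof -
    have "x * (\<alpha> * q + (1 - \<alpha>) * ((1 - \<alpha>) * y)) = r * q"
      if "(r - \<alpha> * x) * q = (1 - \<alpha>)\<^sup>2 * x * y" for x y q :: real
    proof -
      have "r * q = \<alpha> * x * q + (1 - \<alpha>)\<^sup>2 * x * y" using that by (simp add: left_diff_distrib)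
      then show ?thesis unfolding power2_eq_square by (simp only:) (simp add: algebra_simps)
    qed
    then show ?thesis using root by blast
  qed
  have pos: "\<alpha> * ?p + (1 - \<alpha>) * ?q > 0" "\<alpha> * ?q + (1 - \<alpha>) * ?p > 0"
    using pq \<alpha> by (auto intro!: add_nonneg_pos)
  have compare: "A_alpha_op \<alpha> G w u \<le> r * w u \<and> (A_alpha_op \<alpha> G w u = r * w u \<longleftrightarrow> neighbours G u = Z)"
    if "A_alpha_op \<alpha> G w u = card (neighbours G u) * c" "r * w u = card Z * c" "c > 0"
      "neighbours G u \<subseteq> Z" "finite Z" for u Z and c :: real
    unfolding that(1,2) using that(3) card_mono[OF that(5,4)] card_subset_eq[OF that(5,4)] by auto
  assume u: "u \<in> verts G"
  have "A_alpha_op \<alpha> G w u \<le> r * w u \<and>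
      (A_alpha_op \<alpha> G w u = r * w u \<longleftrightarrow> neighbours G u = (if u \<in> X then Y else X))"
  proof (cases "u \<in> X")
    case True
    then have "r * w u = card Y * (\<alpha> * ?p + (1 - \<alpha>) * ?q)"
      unfolding cX by (simp add: w_def)
    from compare[OF opX[OF True] this pos(1) neighbours_subset_parts(1)[OF True] finite_parts(2)]
    show ?thesis using True by simp
  next
    case False
    then have Yu: "u \<in> Y" using u verts_eq by blast
    from False have "r * w u = card X * (\<alpha> * ?q + (1 - \<alpha>) * ?p)"
      unfolding cY by (simp add: w_def)
    from compare[OF opY[OF Yu] this pos(2) neighbours_subset_parts(2)[OF Yu] finite_parts(1)]
    show ?thesis using False by simp
  qed
  then show "A_alpha_op \<alpha> G w u \<le> r * w u"
    and "A_alpha_op \<alpha> G w u = r * w u \<longleftrightarrow> neighbours G u = (if u \<in> X then Y else X)"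
    by blast+
qed

lemma
  assumes \<alpha>: "0 \<le> \<alpha>" "\<alpha> < 1" and ne: "card X > 0" "card Y > 0"
  shows eigenvalue_le_complete_bipartite:
      "eigenfunction \<alpha> G x k \<Longrightarrow> k \<le> A_alpha_bound \<alpha> (card X) (card Y)"
    and complete_if_eigenvalue_eq:
      "eigenfunction \<alpha> G x (A_alpha_bound \<alpha> (card X) (card Y)) \<Longrightarrow> arcs_ends G = X \<times> Y \<union> Y \<times> X"
    and eigenfunction_complete_bipartite:
      "arcs_ends G = X \<times> Y \<union> Y \<times> X \<Longrightarrow> \<exists>x. eigenfunction \<alpha> G x (A_alpha_bound \<alpha> (card X) (card Y))"
proof -
  let ?r = "A_alpha_bound \<alpha> (card X) (card Y)"
  define w where "w u = (if u \<in> X then (1 - \<alpha>) * card Y else ?r - \<alpha> * card Y)" for u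
  note w = A_alpha_op_complete_bipartite[OF \<alpha> ne, folded w_def]
  show "k \<le> ?r" if "eigenfunction \<alpha> G x k"
    by (rule eigenvalue_le_supersolution[OF \<alpha> that w(1,2)])
  show "arcs_ends G = X \<times> Y \<union> Y \<times> X" if x: "eigenfunction \<alpha> G x ?r"
  proof -
    let ?U = "{u \<in> verts G. x u \<noteq> 0}"
    have full: "neighbours G u = (if u \<in> X then Y else X)" if "u \<in> ?U" for u
      using supersolution_tight[OF \<alpha> x w(1,2) refl, of u] w(3)[of u] that by blast
    have closed: "v \<in> ?U" if "u \<in> ?U" "v \<in> neighbours G u" for u v
      using support_closed[OF \<alpha> x w(1,2) refl, of u v] that neighbours_subset by blast
    obtain u where u: "u \<in> ?U" using x by (auto simp: eigenfunction_def)
    have "neighbours G u \<noteq> {}" using full[OF u] ne by auto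
    then obtain v where v: "v \<in> neighbours G u" by blast
    have vU: "v \<in> ?U" by (rule closed[OF u v])
    have "u \<in> X \<and> v \<in> Y \<or> u \<in> Y \<and> v \<in> X"
      using v arcs_ends_subset by (auto simp: neighbours_def)
    \<comment> \<open>The adjacent vertices \<open>u\<close> and \<open>v\<close> lie in different
      parts and each is joined to the whole opposite part, so the closed support contains every
      vertex.\<close>
    then have "neighbours G u \<union> neighbours G v = X \<union> Y"
      using full[OF u] full[OF vU] disjoint by auto
    then have "X \<union> Y \<subseteq> ?U" using closed u vU by blast
    then have "neighbours G u = Y" if "u \<in> X" for u using full[of u] that by auto
    then have "X \<times> Y \<subseteq> arcs_ends G" by (auto simp: neighbours_def)
    then show ?thesis using arcs_ends_subset arcs_ends_sym by blast
  qed
  show "\<exists>x. eigenfunction \<alpha> G x ?r" if "arcs_ends G = X \<times> Y \<union> Y \<times> X"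
  proof -
    have "neighbours G u = (if u \<in> X then Y else X)" if "u \<in> verts G" for u
      using that \<open>arcs_ends G = _\<close> verts_eq disjoint by (auto simp: neighbours_def)
    then have "A_alpha_op \<alpha> G w u = ?r * w u" if "u \<in> verts G" for u
      using w(3)[OF that] that by blast
    moreover obtain u where "u \<in> verts G" using ne verts_eq by (metis UnI1 card_gt_0_iff ex_in_conv)
    ultimately have "eigenfunction \<alpha> G w ?r"
      unfolding eigenfunction_def using w(1) less_irrefl by metis
    then show ?thesis by blast
  qed
qed

end

subsection \<open>Dissociation numbers and the equality case\<close>

context graph
begin

text \<open>A dissociation set that meets both \<open>P\<close> and \<open>Q\<close> has only one
  vertex in each, and these two are outweighed once \<open>card P\<close> is at least 2. A set
  missing one part has size at most \<open>card P + card I\<close>, because \<open>P\<close> is the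
  larger part.\<close>

lemma dissociation_number_complete_bipartite_isolated:
  assumes V: "verts G = P \<union> Q \<union> I" and disj: "P \<inter> Q = {}" "(P \<union> Q) \<inter> I = {}"
    and E: "arcs_ends G = P \<times> Q \<union> Q \<times> P"
    and Q: "0 < card Q" "card Q \<le> card P" and less: "dissociation_number G < card (verts G)"
  shows "dissociation_number G = card P + card I"
proof (rule antisym)
  have fin: "finite P" "finite Q" "finite I" using finite_verts V by auto
  have PI: "card (P \<union> I) = card P + card I" and QI: "card (Q \<union> I) = card Q + card I"
    using disj fin by (auto intro!: card_Un_disjoint)
  have "arcs_ends G \<inter> (P \<union> I) \<times> (P \<union> I) = {}" using disj E by auto
  then show "card P + card I \<le> dissociation_number G"
    using independent_card_le_dissociation_number[of "P \<union> I"] V PI by auto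
  have nP: "neighbours G u = Q" if "u \<in> P" for u using that E disj by (auto simp: neighbours_def)
  have nQ: "neighbours G u = P" if "u \<in> Q" for u using that E disj by (auto simp: neighbours_def)
  have nI: "neighbours G u = {}" if "u \<in> I" for u using that E disj by (auto simp: neighbours_def)
  \<comment> \<open>Otherwise the graph is a single edge with isolated vertices, so its whole vertex
    set is a dissociation set, against \<open>less\<close>.\<close>
  have P2: "2 \<le> card P"
  proof (rule ccontr)
    assume "\<not> 2 \<le> card P"
    then have "card P = 1" "card Q = 1" using Q by auto
    then have "card (neighbours G v) \<le> 1" if "v \<in> verts G" for v
      using that V nP nQ nI by auto
    then have "dissociation_set G (verts G)" by (simp add: dissociation_set_iff Int_absorb2 neighbours_subset)
    then show False using card_le_dissociation_number less by fastforce
  qed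
  obtain S where S: "dissociation_set G S" "card S = dissociation_number G"
    by (rule dissociation_number_attained)
  have SV: "S \<subseteq> P \<union> Q \<union> I" and S1: "\<And>v. v \<in> S \<Longrightarrow> card (neighbours G v \<inter> S) \<le> 1"
    using S V by (auto simp: dissociation_set_iff)
  consider "S \<inter> P = {}" | "S \<inter> Q = {}" | p q where "p \<in> S \<inter> P" "q \<in> S \<inter> Q" by blast
  then have "card S \<le> card P + card I"
  proof cases
    case 1
    then have "card S \<le> card (Q \<union> I)" using SV fin by (intro card_mono) auto
    then show ?thesis using QI Q by simp
  next
    case 2
    then have "card S \<le> card (P \<union> I)" using SV fin by (intro card_mono) auto
    then show ?thesis using PI by simp
  next
    case 3
    then have "card (Q \<inter> S) \<le> 1" "card (P \<inter> S) \<le> 1" using S1[of p] S1[of q] nP nQ by auto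
    moreover have "card S \<le> card ((P \<inter> S) \<union> (Q \<inter> S) \<union> I)"
      using SV fin by (intro card_mono) auto
    moreover have "\<dots> \<le> card (P \<inter> S) + card (Q \<inter> S) + card I"
      by (meson add_right_mono card_Un_le le_trans)
    ultimately show ?thesis using P2 by linarith
  qed
  then show "dissociation_number G \<le> card P + card I" using S by simp
qed

text \<open>With \<open>A\<close> the larger and \<open>B\<close> the smaller of \<open>P\<close>
  and \<open>Q\<close>, the dissociation number is \<open>card A + card I\<close> and its complement
  is \<open>card B\<close>. The product equation then becomes \<open>card I * card B = 0\<close>,
  which rules out isolated vertices.\<close>

lemma complete_bipartite_if_card_eq:
  assumes V: "verts G = P \<union> Q \<union> I" and disj: "P \<inter> Q = {}" "(P \<union> Q) \<inter> I = {}"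
    and E: "arcs_ends G = P \<times> Q \<union> Q \<times> P"
    and ne: "0 < card P" "0 < card Q" and less: "dissociation_number G < card (verts G)"
    and eq: "card P * card Q = dissociation_number G * (card (verts G) - dissociation_number G)"
  shows "complete_bipartite_digraph (dissociation_number G)
           (card (verts G) - dissociation_number G) G"
proof -
  have fin: "finite P" "finite Q" "finite I" using finite_verts V by auto
  have n: "card (verts G) = card P + card Q + card I"
    unfolding V using fin disj by (simp add: card_Un_disjoint)
  have *: "complete_bipartite_digraph (dissociation_number G)
           (card (verts G) - dissociation_number G) G"
    if "verts G = A \<union> B \<union> I" "A \<inter> B = {}" "(A \<union> B) \<inter> I = {}" "arcs_ends G = A \<times> B \<union> B \<times> A"
      "0 < card B" "card B \<le> card A" "card A * card B = card P * card Q"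
      "card A + card B = card P + card Q" for A B
  proof -
    have \<tau>: "dissociation_number G = card A + card I"
      by (rule dissociation_number_complete_bipartite_isolated[OF that(1-6) less])
    then have d: "card (verts G) - dissociation_number G = card B" using n that(8) by simp
    have "card A * card B = dissociation_number G * card B" using eq that(7) unfolding d by simp
    then have "card A * card B = (card A + card I) * card B" unfolding \<tau> .
    then have "card I = 0" using that(5) by simp
    then have "I = {}" using fin by simp
    then show ?thesis
      unfolding complete_bipartite_digraph_def d using that \<tau> graph_axioms
      by (intro conjI exI[of _ A] exI[of _ B]) auto
  qed
  show ?thesis
  proof (cases "card Q \<le> card P")
    case True
    show ?thesis by (rule *[OF V disj E ne(2) True refl refl])
  next
    case False
    show ?thesis by (rule *[of Q P]) (use V disj E ne False in \<open>auto simp: mult.commute\<close>)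
  qed
qed

end

section \<open>Eigenvalue bounds on either side of alpha = 1/2\<close>

context bipartition
begin

lemma edges_swap: "bipartition.edges G Y X = edges\<inverse>"
  using arcs_ends_sym by (auto simp: bipartition.edges_def[OF bipartition_swap] edges_def)

lemma card_edges_swap: "card (bipartition.edges G Y X) = card edges"
  unfolding edges_swap by simp

lemma sum_neighbour_degrees_le:
  assumes "u \<in> verts G"
  shows "(\<Sum>v\<in>neighbours G u. card (neighbours G v)) \<le> card edges"
    and "(\<Sum>v\<in>neighbours G u. card (neighbours G v))
      \<le> card (neighbours G u) * (card (verts G) - card (neighbours G u))"
proof -
  show "(\<Sum>v\<in>neighbours G u. card (neighbours G v)) \<le> card edges"
    using assms sum_neighbour_degrees_le_edges
      bipartition.sum_neighbour_degrees_le_edges[OF bipartition_swap]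
    by (auto simp: verts_eq card_edges_swap)
  have "card (neighbours G v) \<le> card (verts G) - card (neighbours G u)" if v: "v \<in> neighbours G u" for v
  proof -
    \<comment> \<open>Adjacent vertices have their neighbourhoods in opposite parts, so their
      degrees sum to at most the order.\<close>
    have "neighbours G u \<inter> neighbours G v = {}"
      using v arcs_ends_subset disjoint by (auto simp: neighbours_def)
    then have "card (neighbours G u) + card (neighbours G v) = card (neighbours G u \<union> neighbours G v)"
      by (simp add: card_Un_disjoint)
    also have "\<dots> \<le> card (verts G)" using neighbours_subset by (intro card_mono) auto
    finally show ?thesis by simp
  qed
  then show "(\<Sum>v\<in>neighbours G u. card (neighbours G v))
      \<le> card (neighbours G u) * (card (verts G) - card (neighbours G u))"
    using sum_bounded_above[of "neighbours G u" "\<lambda>v. card (neighbours G v)"] by simp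
qed

lemma
  fixes \<alpha> :: real
  defines "n \<equiv> card (verts G)" and "\<tau> \<equiv> dissociation_number G"
  assumes \<alpha>: "0 \<le> \<alpha>" "\<alpha> < 1/2" and less: "\<tau> < n"
  defines "r \<equiv> A_alpha_bound \<alpha> \<tau> (real n - \<tau>)"
  defines "w \<equiv> \<lambda>u. card (neighbours G u) + (r - \<alpha> * n)"
  assumes u: "u \<in> verts G"
  shows degree_weight_pos: "w u > 0"
    and degree_supersolution: "A_alpha_op \<alpha> G w u \<le> r * w u"
    and degree_supersolution_tight:
      "A_alpha_op \<alpha> G w u = r * w u \<Longrightarrow> (\<Sum>v\<in>neighbours G u. card (neighbours G v)) = \<tau> * (n - \<tau>)"
proof -
  define c where "c = r - \<alpha> * n"
  define d where "d = card (neighbours G u)"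
  define s where "s = (\<Sum>v\<in>neighbours G u. card (neighbours G v))"
  \<comment> \<open>Each part has at most \<open>\<tau>\<close> vertices, so
    \<open>\<tau> = 0\<close> would make the graph empty.\<close>
  have "0 < \<tau>"
    using card_part_le_dissociation_number less card_verts unfolding n_def \<tau>_def by linarith
  then have pos: "0 < real \<tau>" "0 < real n - \<tau>" using less by auto
  have c: "c > 0"
    using A_alpha_bound_greater_sum[of \<alpha>, OF _ _ pos] \<alpha> by (simp add: c_def r_def)
  then show "w u > 0" by (simp add: w_def c_def)
  have "(r - \<alpha> * \<tau>) * (r - \<alpha> * (real n - \<tau>)) = (1 - \<alpha>)\<^sup>2 * \<tau> * (real n - \<tau>)"
    using A_alpha_bound_root[of \<alpha>, OF _ _ pos] \<alpha> by (simp add: r_def)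
  then have rc: "r * c = (1 - 2 * \<alpha>) * (\<tau> * (real n - \<tau>))"
    unfolding c_def by (simp add: power2_eq_square algebra_simps)
  have "(\<Sum>v\<in>neighbours G u. w v) = real s + d * c"
    by (simp add: w_def s_def d_def c_def sum.distrib)
  then have "A_alpha_op \<alpha> G w u = \<alpha> * d * (d + c) + (1 - \<alpha>) * (s + d * c)"
    by (simp add: A_alpha_op_def w_def d_def c_def)
  moreover have "r * w u = r * c + (\<alpha> * n + c) * d"
    by (simp add: w_def d_def c_def algebra_simps)
  \<comment> \<open>The shift \<open>c\<close> makes the terms \<open>d * c\<close> cancel, and
    \<open>r * c\<close> is computed from the quadratic for \<open>r\<close>. What remains is a
    combination of the slacks of the two estimates for \<open>s\<close>. In the equality case only
    the second is used: its coefficient \<open>1 - 2 * \<alpha>\<close> is positive, while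
    \<open>\<alpha>\<close> may be 0.\<close>
  ultimately have diff: "r * w u - A_alpha_op \<alpha> G w u =
      \<alpha> * (d * (real n - d) - s) + (1 - 2 * \<alpha>) * (\<tau> * (real n - \<tau>) - s)"
    unfolding rc by (simp add: algebra_simps)
  have "d \<le> n" using neighbours_subset unfolding d_def n_def by (intro card_mono) auto
  have "s \<le> d * (n - d)" using sum_neighbour_degrees_le(2)[OF u] by (simp add: s_def d_def n_def)
  then have "real s \<le> real (d * (n - d))" by (rule of_nat_mono)
  then have A: "0 \<le> \<alpha> * (d * (real n - d) - s)"
    using \<alpha> \<open>d \<le> n\<close> by (simp add: of_nat_diff)
  have "s \<le> \<tau> * (n - \<tau>)"
    using sum_neighbour_degrees_le(1)[OF u] card_edges_le less by (simp add: s_def \<tau>_def n_def)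
  then have "real s \<le> real (\<tau> * (n - \<tau>))" by (rule of_nat_mono)
  then have s: "real s \<le> \<tau> * (real n - \<tau>)" using less by (simp add: of_nat_diff)
  then have B: "0 \<le> (1 - 2 * \<alpha>) * (\<tau> * (real n - \<tau>) - s)" using \<alpha> by simp
  show "A_alpha_op \<alpha> G w u \<le> r * w u" using diff A B by linarith
  assume "A_alpha_op \<alpha> G w u = r * w u"
  then have "(1 - 2 * \<alpha>) * (\<tau> * (real n - \<tau>) - s) = 0" using diff A B by linarith
  then have "real s = \<tau> * (real n - \<tau>)" using \<alpha> by simp
  also have "\<dots> = real (\<tau> * (n - \<tau>))" using less by (simp add: of_nat_diff)
  finally have "s = \<tau> * (n - \<tau>)" by (simp only: of_nat_eq_iff)
  then show "(\<Sum>v\<in>neighbours G u. card (neighbours G v)) = \<tau> * (n - \<tau>)" by (simp add: s_def)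
qed

lemma
  fixes \<alpha> :: real
  defines "n \<equiv> card (verts G)" and "\<tau> \<equiv> dissociation_number G"
  assumes \<alpha>: "0 \<le> \<alpha>" "\<alpha> < 1/2" and less: "\<tau> < n"
  defines "r \<equiv> A_alpha_bound \<alpha> \<tau> (real n - \<tau>)"
  shows eigenvalue_le_if_alpha_less_half: "eigenfunction \<alpha> G x k \<Longrightarrow> k \<le> r"
    and complete_bipartite_if_alpha_less_half:
      "eigenfunction \<alpha> G x r \<Longrightarrow> complete_bipartite_digraph \<tau> (n - \<tau>) G"
proof -
  define w where "w u = card (neighbours G u) + (r - \<alpha> * n)" for u
  have \<alpha>1: "\<alpha> < 1" using \<alpha> by simp
  note w = degree_weight_pos[OF \<alpha> less[unfolded n_def \<tau>_def], folded n_def \<tau>_def, folded r_def, folded w_def]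
    degree_supersolution[OF \<alpha> less[unfolded n_def \<tau>_def], folded n_def \<tau>_def, folded r_def, folded w_def]
  note tight = degree_supersolution_tight[OF \<alpha> less[unfolded n_def \<tau>_def],
      folded n_def \<tau>_def, folded r_def, folded w_def]
  show "k \<le> r" if "eigenfunction \<alpha> G x k"
    by (rule eigenvalue_le_supersolution[OF \<alpha>(1) \<alpha>1 that w])
  assume x: "eigenfunction \<alpha> G x r"
  define U where "U = {u \<in> verts G. x u \<noteq> 0}"
  let ?s = "\<lambda>u. \<Sum>v\<in>neighbours G u. card (neighbours G v)"
  have le: "card edges \<le> \<tau> * (n - \<tau>)" using card_edges_le less by (simp add: \<tau>_def n_def)
  have sU: "?s u = \<tau> * (n - \<tau>)" if "u \<in> U" for u
    using supersolution_tight[OF \<alpha>(1) \<alpha>1 x w refl, of u] tight[of u] that by (auto simp: U_def)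
  have closed: "v \<in> U" if "u \<in> U" "v \<in> neighbours G u" for u v
    using support_closed[OF \<alpha>(1) \<alpha>1 x w refl, of u v] that neighbours_subset by (auto simp: U_def)
  have "0 < \<tau>"
    using card_part_le_dissociation_number less card_verts unfolding n_def \<tau>_def by linarith
  then have t: "0 < \<tau> * (n - \<tau>)" using less by simp
  obtain u where u: "u \<in> U" using x by (auto simp: eigenfunction_def U_def)
  have "neighbours G u \<noteq> {}" using sU[OF u] t by auto
  then obtain v where v: "v \<in> neighbours G u" by blast
  \<comment> \<open>An edge inside the support, with one end in each part, lets the tightness be
    applied from both sides.\<close>
  have "\<exists>p\<in>U. \<exists>q\<in>U. (p, q) \<in> edges"
  proof (cases "u \<in> X")
    case True
    then show ?thesis using edges_iff_neighbours(2) u v closed[OF u v] by blast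
  next
    case False
    then have "u \<in> Y" using u verts_eq by (auto simp: U_def)
    then show ?thesis using edges_iff_neighbours(1) u v closed[OF u v] by blast
  qed
  then obtain p q where pq: "p \<in> U" "q \<in> U" "(p, q) \<in> edges" by blast
  then have XY: "p \<in> X" "q \<in> Y" using edges_subset by auto
  define P Q I where "P = neighbours G q" and "Q = neighbours G p" and "I = verts G - (P \<union> Q)"
  have PQ: "P \<subseteq> X" "Q \<subseteq> Y" using neighbours_subset_parts XY by (auto simp: P_def Q_def)
  \<comment> \<open>A support vertex in \<open>X\<close> is adjacent to the \<open>Y\<close>-end of
    every edge, and \<open>toY\<close> is the mirror statement.\<close>
  have toX: "(a, b') \<in> edges" if "a \<in> U" "a \<in> X" "(a', b') \<in> edges" for a a' b'
    by (rule edges_if_sum_neighbour_degrees_ge[OF that(2) _ that(3)]) (use sU[OF that(1)] le in simp)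
  have toY: "(a', b) \<in> edges" if "b \<in> U" "b \<in> Y" "(a', b') \<in> edges" for b a' b'
  proof -
    have "(b, a') \<in> bipartition.edges G Y X"
      by (rule bipartition.edges_if_sum_neighbour_degrees_ge[OF bipartition_swap that(2), where a = b'])
        (use that sU[OF that(1)] le in \<open>auto simp: edges_swap\<close>)
    then show ?thesis by (simp add: edges_swap)
  qed
  \<comment> \<open>For an edge \<open>(a, b)\<close>, \<open>p\<close> is adjacent to
    \<open>b\<close> and \<open>q\<close> to \<open>a\<close>. Conversely any \<open>a\<close> in
    \<open>P\<close> lies in the support as a neighbour of \<open>q\<close>, hence is adjacent to
    every \<open>b\<close> in \<open>Q\<close>, the \<open>Y\<close>-end of the edge
    \<open>(p, b)\<close>.\<close>
  have "edges = P \<times> Q"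
  proof
    show "edges \<subseteq> P \<times> Q"
    proof
      fix e assume "e \<in> edges"
      then obtain a b where e: "e = (a, b)" "(a, b) \<in> edges" by (cases e) auto
      have "(p, b) \<in> edges" "(a, q) \<in> edges" using toX toY pq XY e(2) by blast+
      then show "e \<in> P \<times> Q" using e XY edges_iff_neighbours by (auto simp: P_def Q_def)
    qed
    show "P \<times> Q \<subseteq> edges"
    proof
      fix e assume "e \<in> P \<times> Q"
      then obtain a b where e: "e = (a, b)" "a \<in> P" "b \<in> Q" by auto
      have "(p, b) \<in> edges" using e XY edges_iff_neighbours(2) by (simp add: Q_def)
      moreover have "a \<in> U" using closed[OF pq(2)] e by (simp add: P_def)
      ultimately show "e \<in> edges" using toX PQ e by blast
    qed
  qed
  then have E: "arcs_ends G = P \<times> Q \<union> Q \<times> P"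
    using arcs_ends_subset arcs_ends_sym unfolding edges_def by blast
  have fin: "finite P" "finite Q" by (simp_all add: P_def Q_def)
  have "card edges = \<tau> * (n - \<tau>)"
    using sum_neighbour_degrees_le(1)[of p] sU[OF pq(1)] le pq(1) by (simp add: U_def)
  then have card: "card P * card Q = \<tau> * (n - \<tau>)"
    unfolding \<open>edges = P \<times> Q\<close> by (simp add: card_cartesian_product)
  have V: "verts G = P \<union> Q \<union> I" using neighbours_subset by (auto simp: I_def P_def Q_def)
  have "P \<inter> Q = {}" using PQ disjoint by blast
  moreover have "(P \<union> Q) \<inter> I = {}" by (auto simp: I_def)
  moreover have "0 < card P" "0 < card Q" using card t by (metis mult_is_0 neq0_conv)+
  ultimately show "complete_bipartite_digraph \<tau> (n - \<tau>) G"
    unfolding n_def \<tau>_def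
    using complete_bipartite_if_card_eq[OF V _ _ E] less card by (simp add: n_def \<tau>_def)
qed

lemma
  fixes \<alpha> :: real
  defines "n \<equiv> card (verts G)" and "\<tau> \<equiv> dissociation_number G"
  assumes \<alpha>: "1/2 \<le> \<alpha>" "\<alpha> < 1" and less: "\<tau> < n" and parts: "card Y \<le> card X"
  defines "r \<equiv> A_alpha_bound \<alpha> \<tau> (real n - \<tau>)"
  shows eigenvalue_le_if_alpha_ge_half: "eigenfunction \<alpha> G x k \<Longrightarrow> k \<le> r"
    and complete_bipartite_if_alpha_ge_half:
      "eigenfunction \<alpha> G x r \<Longrightarrow> complete_bipartite_digraph \<tau> (n - \<tau>) G"
proof -
  let ?b = "A_alpha_bound \<alpha> (card X) (card Y)"
  have X: "card X \<le> \<tau>" using card_part_le_dissociation_number by (simp add: \<tau>_def)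
  have n: "n = card X + card Y" by (simp add: n_def card_verts)
  have ne: "0 < card X" "0 < card Y" using X less parts n by linarith+
  have \<alpha>0: "0 \<le> \<alpha>" using \<alpha> by simp
  \<comment> \<open>Both factors are nonnegative because
    \<open>card Y \<le> card X \<le> \<tau>\<close>; expanding gives
    \<open>\<tau> * (n - \<tau>) \<le> card X * card Y\<close>.\<close>
  have "(real \<tau> - card X) * (real \<tau> - card Y) \<ge> 0" using X parts by simp
  then have "\<tau> * (real n - \<tau>) \<le> real (card X) * card Y" unfolding n by (simp add: algebra_simps)
  then have b: "?b \<le> r"
    unfolding r_def using \<alpha> by (intro A_alpha_bound_antimono) (simp_all add: n)
  show "k \<le> r" if "eigenfunction \<alpha> G x k"
    using eigenvalue_le_complete_bipartite[OF \<alpha>0 \<alpha>(2) ne that] b by linarith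
  assume x: "eigenfunction \<alpha> G x r"
  then have "r = ?b" using eigenvalue_le_complete_bipartite[OF \<alpha>0 \<alpha>(2) ne x] b by linarith
  then have E: "arcs_ends G = X \<times> Y \<union> Y \<times> X"
    using complete_if_eigenvalue_eq[OF \<alpha>0 \<alpha>(2) ne] x by simp
  \<comment> \<open>Completeness has no isolated vertices to account for, so the formula is applied
    with an empty third set.\<close>
  have "\<tau> = card X + card ({} :: 'a set)"
    unfolding \<tau>_def
    by (rule dissociation_number_complete_bipartite_isolated[OF _ disjoint _ E ne(2) parts])
      (use verts_eq less in \<open>auto simp: \<tau>_def n_def\<close>)
  then show "complete_bipartite_digraph \<tau> (n - \<tau>) G"
    unfolding complete_bipartite_digraph_def using E verts_eq disjoint graph_axioms n
    by (intro conjI exI[of _ X] exI[of _ Y]) auto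
qed

end

theorem theorem1p2:
  fixes G :: "('a, 'b) pre_digraph" and vs :: "'a list" and n \<tau> :: nat and \<alpha> :: real
  assumes "bipartite_graph G"
    and "n = card (verts G)"
    and "\<tau> = dissociation_number G"
    and "\<tau> < n"
    and "0 \<le> \<alpha>" and "\<alpha> < 1"
    and "vertex_ordering G vs"
  shows "A_alpha_index \<alpha> G vs
           \<le> 1/2 * (\<alpha> * real n
                + sqrt (\<alpha>^2 * (real n)^2 + 4 * real \<tau> * (real n - real \<tau>) * (1 - 2 * \<alpha>)))
       \<and> (A_alpha_index \<alpha> G vs
           = 1/2 * (\<alpha> * real n
                + sqrt (\<alpha>^2 * (real n)^2 + 4 * real \<tau> * (real n - real \<tau>) * (1 - 2 * \<alpha>)))
          \<longleftrightarrow> complete_bipartite_digraph \<tau> (n - \<tau>) G)"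
proof -
  obtain X' Y' where "bipartition G X' Y'"
    using assms(1) unfolding bipartite_graph_def bipartition_def bipartition_axioms_def by blast
  \<comment> \<open>Naming the larger part \<open>X\<close> prepares the case of alpha at least
    1/2.\<close>
  then obtain X Y where "bipartition G X Y" and parts: "card Y \<le> card X"
    using bipartition.bipartition_swap nat_le_linear by metis
  then interpret bipartition G X Y by simp
  note less = assms(4)[unfolded assms(2,3)]
  let ?r = "A_alpha_bound \<alpha> \<tau> (real n - \<tau>)"
  have "verts G \<noteq> {}" using assms(2,4) by auto
  then obtain x where x: "eigenfunction \<alpha> G x (A_alpha_index \<alpha> G vs)"
    using A_alpha_index_attained[OF assms(7)] by blast
  have le: "A_alpha_index \<alpha> G vs \<le> ?r"
    using eigenvalue_le_if_alpha_less_half[OF assms(5) _ less x]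
      eigenvalue_le_if_alpha_ge_half[OF _ assms(6) less parts x]
    unfolding assms(2,3) by linarith
  have "complete_bipartite_digraph \<tau> (n - \<tau>) G" if "A_alpha_index \<alpha> G vs = ?r"
  proof (cases "\<alpha> < 1/2")
    case True
    then show ?thesis
      using complete_bipartite_if_alpha_less_half[OF assms(5) True less] x that
      unfolding assms(2,3) by simp
  next
    case False
    then have "1/2 \<le> \<alpha>" by simp
    then show ?thesis
      using complete_bipartite_if_alpha_ge_half[OF _ assms(6) less parts] x that
      unfolding assms(2,3) by simp
  qed
  moreover have "A_alpha_index \<alpha> G vs = ?r" if K: "complete_bipartite_digraph \<tau> (n - \<tau>) G"
  proof -
    obtain U V where UV: "verts G = U \<union> V" "U \<inter> V = {}" "card U = \<tau>" "card V = n - \<tau>"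
        "arcs_ends G = U \<times> V \<union> V \<times> U"
      using K unfolding complete_bipartite_digraph_def by (elim conjE exE) (rule that)
    \<comment> \<open>The parts \<open>U\<close> and \<open>V\<close> of the isomorphism type need
      not be the chosen \<open>X\<close> and \<open>Y\<close>; their Perron vector shows that
      \<open>?r\<close> is an eigenvalue.\<close>
    interpret UV: bipartition G U V by unfold_locales (use UV in simp_all)
    have "0 < \<tau>"
      using card_part_le_dissociation_number assms(2,3,4) card_verts by linarith
    then have "\<exists>y. eigenfunction \<alpha> G y (A_alpha_bound \<alpha> (card U) (card V))"
      using UV.eigenfunction_complete_bipartite[OF assms(5,6) _ _ UV(5)] UV(3,4) assms(4) by simp
    then have "?r \<le> A_alpha_index \<alpha> G vs"
      using A_alpha_index_ge[OF assms(7) \<open>verts G \<noteq> {}\<close>] UV(3,4) assms(4)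
      by (auto simp: of_nat_diff)
    then show ?thesis using le by simp
  qed
  moreover have "?r = 1/2 * (\<alpha> * real n
      + sqrt (\<alpha>^2 * (real n)^2 + 4 * real \<tau> * (real n - real \<tau>) * (1 - 2 * \<alpha>)))"
    by (simp add: A_alpha_bound_def)
  ultimately show ?thesis using le by metis
qed

end
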